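(* Let $G\le\mathrm{Sym}(n)$ be $2$-transitive and let $\mathcal{C}$ be a union of derangement conjugacy classes of $G$. Assume: (a) $G$ has the EKR property with respect to $\mathcal{C}$; (b) for every maximum independent set $S\subseteq G$ with respect to $\mathcal{C}$, the characteristic vector $v_S$ lies in the direct sum of the trivial and the standard modules of $G$; and (c) the matrix $M$ of $G$ with respect to $\mathcal{C}$ has full rank (rank $(n-1)(n-2)$). Then $G$ has the strict EKR property with respect to $\mathcal{C}$.
   Context: $G$ acts naturally on $[n]$; a derangement conjugacy class is a conjugacy class whose elements fix no point of $[n]$. A subset $S\subseteq G$ is independent with respect to $\mathcal{C}$ if there are no $\pi,\sigma\in S$ with $\pi\sigma^{-1}\in\mathcal{C}$. $G$ has the EKR property with respect to $\mathcal{C}$ if every such independent set has size at most the size of the largest point-stabilizer, and the strict EKR property with respect to $\mathcal{C}$ if moreover every independent set of maximum size is a coset of a point-stabilizer, i.e. of the form $\{\pi\in G:\pi(i)=j\}$. For an irreducible character $\chi$ of $G$, $E_\chi$ is the $G\times G$ matrix with entries $(E_\chi)_{\pi,\sigma}=\frac{\chi(1)}{|G|}\chi(\pi^{-1}\sigma)$ and the $\chi$-module is its column space in $\mathbb{C}^G$; the trivial and standard modules correspond to the trivial character and the standard character $\chi(g)=|\mathrm{fix}(g)|-1$. The matrix $M$ of $G$ with respect to $\mathcal{C}$ has rows indexed by elements of $\mathcal{C}$ and columns indexed by ordered pairs $(i,j)$, $i,j\in[n-1]$, $i\neq j$, with $(\sigma,(i,j))$ entry $1$ if $\sigma(i)=j$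 and $0$ otherwise. *)

theory Defs
  imports
    Complex_Main
    "HOL-Algebra.Sym_Groups"
    "HOL-Library.Function_Algebras"
    "HOL-Library.Indicator_Function"
begin

definition two_transitive :: "nat \<Rightarrow> (nat \<Rightarrow> nat) set \<Rightarrow> bool" where
  "two_transitive n G \<longleftrightarrow>
     (\<forall>i\<in>{1..n}. \<forall>j\<in>{1..n}. \<forall>k\<in>{1..n}. \<forall>l\<in>{1..n}.
        i \<noteq> j \<longrightarrow> k \<noteq> l \<longrightarrow> (\<exists>\<pi>\<in>G. \<pi> i = k \<and> \<pi> j = l))"

definition conj_class :: "('a \<Rightarrow> 'a) set \<Rightarrow> ('a \<Rightarrow> 'a) \<Rightarrow> ('a \<Rightarrow> 'a) set" where
  "conj_class G g = {h \<circ> g \<circ> inv' h |h. h \<in> G}"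

definition derangement_classes :: "nat \<Rightarrow> (nat \<Rightarrow> nat) set \<Rightarrow> (nat \<Rightarrow> nat) set set" where
  "derangement_classes n G =
     {K. (\<exists>g\<in>G. K = conj_class G g) \<and> (\<forall>\<pi>\<in>K. \<forall>i\<in>{1..n}. \<pi> i \<noteq> i)}"

definition independent_wrt ::
  "('a \<Rightarrow> 'a) set \<Rightarrow> ('a \<Rightarrow> 'a) set \<Rightarrow> ('a \<Rightarrow> 'a) set \<Rightarrow> bool" where
  "independent_wrt G C S \<longleftrightarrow>
     S \<subseteq> G \<and> \<not> (\<exists>\<pi>\<in>S. \<exists>\<sigma>\<in>S. \<pi> \<circ> inv' \<sigma> \<in> C)"

definition max_independent_wrt ::
  "('a \<Rightarrow> 'a) set \<Rightarrow> ('a \<Rightarrow> 'a) set \<Rightarrow> ('a \<Rightarrow> 'a) set \<Rightarrow> bool" where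
  "max_independent_wrt G C S \<longleftrightarrow>
     independent_wrt G C S \<and> (\<forall>T. independent_wrt G C T \<longrightarrow> card T \<le> card S)"

definition point_stabilizer :: "('a \<Rightarrow> 'a) set \<Rightarrow> 'a \<Rightarrow> ('a \<Rightarrow> 'a) set" where
  "point_stabilizer G i = {\<pi> \<in> G. \<pi> i = i}"

definition EKR_property :: "nat \<Rightarrow> (nat \<Rightarrow> nat) set \<Rightarrow> (nat \<Rightarrow> nat) set \<Rightarrow> bool" where
  "EKR_property n G C \<longleftrightarrow>
     (\<forall>S. independent_wrt G C S \<longrightarrow>
        card S \<le> Max ((\<lambda>i. card (point_stabilizer G i)) ` {1..n}))"

definition strict_EKR_property :: "nat \<Rightarrow> (nat \<Rightarrow> nat) set \<Rightarrow> (nat \<Rightarrow> nat) set \<Rightarrow> bool" where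
  "strict_EKR_property n G C \<longleftrightarrow>
     EKR_property n G C \<and>
     (\<forall>S. max_independent_wrt G C S \<longrightarrow>
        (\<exists>i\<in>{1..n}. \<exists>j\<in>{1..n}. S = {\<pi> \<in> G. \<pi> i = j}))"

text \<open>
  For a finite index set \<open>R\<close>, the space of complex column vectors indexed by \<open>R\<close> is
  represented by the functions of type \<open>'r \<Rightarrow> complex\<close> that vanish outside \<open>R\<close>.
\<close>

definition cscale :: "complex \<Rightarrow> ('r \<Rightarrow> complex) \<Rightarrow> 'r \<Rightarrow> complex" where
  "cscale c f = (\<lambda>x. c * f x)"

interpretation cfun: vector_space cscale
  by unfold_locales (auto simp: cscale_def fun_eq_iff algebra_simps)

definition column_space ::
  "'r set \<Rightarrow> 'c set \<Rightarrow> ('r \<Rightarrow> 'c \<Rightarrow> complex) \<Rightarrow> ('r \<Rightarrow> complex) set" where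
  "column_space R K A = cfun.span ((\<lambda>k r. if r \<in> R then A r k else 0) ` K)"

definition matrix_rank :: "'r set \<Rightarrow> 'c set \<Rightarrow> ('r \<Rightarrow> 'c \<Rightarrow> complex) \<Rightarrow> nat" where
  "matrix_rank R K A = cfun.dim (column_space R K A)"

definition E_matrix ::
  "('a \<Rightarrow> 'a) set \<Rightarrow> (('a \<Rightarrow> 'a) \<Rightarrow> complex) \<Rightarrow> ('a \<Rightarrow> 'a) \<Rightarrow> ('a \<Rightarrow> 'a) \<Rightarrow> complex" where
  "E_matrix G \<chi> \<pi> \<sigma> = \<chi> id / of_nat (card G) * \<chi> (inv' \<pi> \<circ> \<sigma>)"

definition character_module ::
  "('a \<Rightarrow> 'a) set \<Rightarrow> (('a \<Rightarrow> 'a) \<Rightarrow> complex) \<Rightarrow> (('a \<Rightarrow> 'a) \<Rightarrow> complex) set" where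
  "character_module G \<chi> = column_space G G (E_matrix G \<chi>)"

definition trivial_character :: "(nat \<Rightarrow> nat) \<Rightarrow> complex" where
  "trivial_character g = 1"

definition standard_character :: "nat \<Rightarrow> (nat \<Rightarrow> nat) \<Rightarrow> complex" where
  "standard_character n g = of_nat (card {i \<in> {1..n}. g i = i}) - 1"

definition M_columns :: "nat \<Rightarrow> (nat \<times> nat) set" where
  "M_columns n = {(i, j). i \<in> {1..n - 1} \<and> j \<in> {1..n - 1} \<and> i \<noteq> j}"

definition M_matrix :: "(nat \<Rightarrow> nat) \<Rightarrow> nat \<times> nat \<Rightarrow> complex" where
  "M_matrix \<sigma> = (\<lambda>(i, j). if \<sigma> i = j then 1 else 0)"

end

theory Submission
  imports Defs
begin

text \<open>
  Translating \<open>S\<close>, assume \<open>id \<in> S\<close>. The trivial and standard modules are spanned by the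
  characteristic vectors \<open>v\<^sub>i\<^sub>j\<close> of the sets \<open>{\<pi>. \<pi> i = j}\<close>, and for \<open>n \<ge> 3\<close> the \<open>v\<^sub>i\<^sub>j\<close> with
  \<open>i \<noteq> j\<close> in \<open>[n - 1]\<close> together with the \<open>v\<^sub>i\<^sub>i\<close>, \<open>i \<in> [n]\<close>, already suffice. On \<open>C\<close> both \<open>v\<^sub>S\<close> and
  all \<open>v\<^sub>i\<^sub>i\<close> vanish, so the coefficients of the remaining vectors lie in the kernel of \<open>M\<close>, which
  is trivial. Hence \<open>v\<^sub>S = \<Sum>i. b\<^sub>i v\<^sub>i\<^sub>i\<close>. By Jordan's theorem on derangements, applied to the
  transitive action of a point stabilizer on the other points, some element of \<open>G\<close> fixes only
  \<open>x\<close>; evaluating there gives \<open>b\<^sub>x \<in> {0, 1}\<close>, while evaluating at \<open>id\<close> gives \<open>\<Sum>i. b\<^sub>i = 1\<close>.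
\<close>

section \<open>Linear algebra: matrices of full column rank\<close>

lemma sum_fun_apply: "(\<Sum>k\<in>K. f k) x = (\<Sum>k\<in>K. f k x)"
  for f :: "'k \<Rightarrow> 'a \<Rightarrow> 'b::comm_monoid_add"
  by (induction K rule: infinite_finite_induct) auto

text \<open>The columns span a space whose dimension is the number of column indices, so they are
  pairwise distinct and independent.\<close>

lemma matrix_rank_full_imp_kernel_trivial:
  assumes fin: "finite K" and rank: "matrix_rank R K A = card K"
    and ker: "\<And>r. r \<in> R \<Longrightarrow> (\<Sum>k\<in>K. a k * A r k) = 0"
    and k: "k \<in> K"
  shows "a k = 0"
proof -
  define col where "col = (\<lambda>k r. if r \<in> R then A r k else 0)"
  have dim: "cfun.dim (col ` K) = card K"
    using rank by (simp add: matrix_rank_def column_space_def col_def)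
  have inj: "inj_on col K"
    using dim cfun.dim_le_card'[of "col ` K"] fin card_image_le[OF fin, of col]
    by (intro eq_card_imp_inj_on) auto
  have "cfun.independent (col ` K)"
  proof
    assume "cfun.dependent (col ` K)"
    then obtain v where v: "v \<in> col ` K" "v \<in> cfun.span (col ` K - {v})"
      by (auto simp: cfun.dependent_def)
    \<comment> \<open>Dropping a dependent column keeps the span, so fewer than
      \<open>card K\<close> vectors would suffice.\<close>
    have "col ` K \<subseteq> cfun.span (col ` K - {v})"
    proof
      fix x assume "x \<in> col ` K"
      then show "x \<in> cfun.span (col ` K - {v})"
        using v(2) by (cases "x = v") (auto intro: cfun.span_base)
    qed
    then have "cfun.dim (col ` K) \<le> card (col ` K - {v})"
      using fin by (intro cfun.dim_le_card) auto
    also have "\<dots> < card (col ` K)"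
      using v fin by (intro psubset_card_mono) auto
    finally show False
      using dim inj by (simp add: card_image)
  qed
  \<comment> \<open>Independence speaks of a set of vectors; injectivity of \<open>col\<close>
    carries the coefficients over from indices to vectors.\<close>
  moreover have "(\<Sum>v\<in>col ` K. cscale (a (the_inv_into K col v)) v) = 0"
  proof -
    have "(\<Sum>v\<in>col ` K. cscale (a (the_inv_into K col v)) v) = (\<Sum>k\<in>K. cscale (a k) (col k))"
      using inj by (subst sum.reindex) (auto simp: the_inv_into_f_f intro!: sum.cong)
    also have "\<dots> = 0"
    proof
      fix r
      show "(\<Sum>k\<in>K. cscale (a k) (col k)) r = 0 r"
        using ker[of r] by (cases "r \<in> R") (simp_all add: sum_fun_apply cscale_def col_def)
    qed
    finally show ?thesis .
  qed
  ultimately have "a (the_inv_into K col (col k)) = 0"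
    using fin k cfun.independentD[of "col ` K" "col ` K" "\<lambda>v. a (the_inv_into K col v)" "col k"]
    by blast
  then show ?thesis
    using inj k by (simp add: the_inv_into_f_f)
qed

lemma card_M_columns: "card (M_columns n) = (n - 1) * (n - 2)"
proof -
  have "M_columns n = {1..n - 1} \<times> {1..n - 1} - (\<lambda>i. (i, i)) ` {1..n - 1}"
    by (auto simp: M_columns_def)
  moreover have "card \<dots> = (n - 1) * (n - 1) - (n - 1)"
    by (subst card_Diff_subset) (auto simp: card_image inj_on_def)
  moreover have "(n - 1) * (n - 1) - (n - 1) = (n - 1) * (n - 2)"
    by (simp add: diff_mult_distrib2 numeral_2_eq_2)
  ultimately show ?thesis
    by simp
qed

lemma finite_M_columns: "finite (M_columns n)"
  by (rule finite_subset[of _ "{1..n} \<times> {1..n}"]) (auto simp: M_columns_def)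

section \<open>Functions in the trivial and standard modules\<close>

text \<open>The functions \<open>\<pi> \<mapsto> \<Sum>i. c i (\<pi> i)\<close> are the linear combinations of the \<open>v\<^sub>i\<^sub>j\<close>.\<close>

definition coset_sum :: "nat \<Rightarrow> (nat \<Rightarrow> nat \<Rightarrow> complex) \<Rightarrow> (nat \<Rightarrow> nat) \<Rightarrow> complex" where
  "coset_sum n c \<pi> = (\<Sum>i=1..n. c i (\<pi> i))"

lemma column_space_coset_sum:
  assumes "f \<in> column_space R K A"
    and "\<And>k. k \<in> K \<Longrightarrow> \<exists>c. \<forall>\<pi>\<in>R. A \<pi> k = coset_sum n c \<pi>"
  shows "\<exists>c. \<forall>\<pi>\<in>R. f \<pi> = coset_sum n c \<pi>"
  using assms(1) unfolding column_space_def
proof (induction rule: cfun.span_induct_alt)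
  case base
  show ?case
    by (rule exI[of _ "\<lambda>_ _. 0"]) (simp add: coset_sum_def)
next
  case (step z x y)
  then obtain c d where c: "\<forall>\<pi>\<in>R. x \<pi> = coset_sum n c \<pi>" and d: "\<forall>\<pi>\<in>R. y \<pi> = coset_sum n d \<pi>"
    using assms(2) by force
  then show ?case
    by (intro exI[of _ "\<lambda>i j. z * c i j + d i j"])
      (auto simp: coset_sum_def cscale_def sum.distrib sum_distrib_left)
qed

lemma coset_sum_const:
  assumes "1 \<le> n"
  shows "coset_sum n (\<lambda>i j. if i = 1 then z else 0) \<pi> = z"
  using assms by (simp add: coset_sum_def)

lemma trivial_module_coset_sum:
  assumes "f \<in> character_module G trivial_character" and "1 \<le> n"
  shows "\<exists>c. \<forall>\<pi>\<in>G. f \<pi> = coset_sum n c \<pi>"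
  using assms(1) unfolding character_module_def
  by (rule column_space_coset_sum)
    (auto simp: E_matrix_def trivial_character_def
      intro!: exI[of _ "\<lambda>i j. if i = 1 then _ else 0"] coset_sum_const[OF assms(2), symmetric])

text \<open>The fixed points of \<open>inv' \<pi> \<circ> \<sigma>\<close> are the points where
  \<pi> and \<sigma> agree. So, up to a scalar, column \<sigma> is a sum of characteristic vectors
  minus a constant, and row 1 absorbs the constant.\<close>

lemma standard_module_coset_sum:
  assumes f: "f \<in> character_module G (standard_character n)" and n: "1 \<le> n"
    and G: "\<And>\<pi>. \<pi> \<in> G \<Longrightarrow> \<pi> permutes {1..n}"
  shows "\<exists>c. \<forall>\<pi>\<in>G. f \<pi> = coset_sum n c \<pi>"
  using f unfolding character_module_def
proof (rule column_space_coset_sum)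
  fix \<sigma> assume \<sigma>: "\<sigma> \<in> G"
  define z where "z = standard_character n id / of_nat (card G)"
  define c where "c i j = z * (of_bool (j = \<sigma> i) - (if i = 1 then 1 else 0))" for i j
  have "E_matrix G (standard_character n) \<pi> \<sigma> = coset_sum n c \<pi>" if \<pi>: "\<pi> \<in> G" for \<pi>
  proof -
    have "inv' \<pi> (\<sigma> i) = i \<longleftrightarrow> \<pi> i = \<sigma> i" for i
      using permutes_inv_eq[OF G[OF \<pi>]] by auto
    then have "of_nat (card {i \<in> {1..n}. (inv' \<pi> \<circ> \<sigma>) i = i}) =
        (\<Sum>i=1..n. of_bool (\<pi> i = \<sigma> i) :: complex)"
      by (simp add: Int_def)
    then have "E_matrix G (standard_character n) \<pi> \<sigma> =
        z * ((\<Sum>i=1..n. of_bool (\<pi> i = \<sigma> i)) - (\<Sum>i=1..n. if i = 1 then 1 else 0))"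
      using n by (simp add: E_matrix_def standard_character_def z_def)
    also have "\<dots> = coset_sum n c \<pi>"
      by (simp only: coset_sum_def c_def sum_subtractf flip: sum_distrib_left)
    finally show ?thesis .
  qed
  then show "\<exists>c. \<forall>\<pi>\<in>G. E_matrix G (standard_character n) \<pi> \<sigma> = coset_sum n c \<pi>"
    by blast
qed

text \<open>
  Replacing \<open>c i j\<close> by \<open>c i j + \<alpha> i + \<beta> j\<close> does not change the sum if \<open>\<Sum>\<alpha> + \<Sum>\<beta> = 0\<close>. Solving
  for a vanishing last row and column leaves an equation with leading coefficient \<open>n - 2\<close>, so the
  statement fails for \<open>n = 2\<close>.
\<close>

lemma coset_sum_normal_form:
  assumes n: "3 \<le> n"
  obtains d where "\<And>\<pi>. \<pi> permutes {1..n} \<Longrightarrow> coset_sum n c \<pi> = coset_sum n d \<pi>"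
    and "\<And>i. i \<in> {1..<n} \<Longrightarrow> d i n = 0" and "\<And>j. j \<in> {1..<n} \<Longrightarrow> d n j = 0"
proof -
  \<comment> \<open>With \<open>\<beta> n = 0\<close>, the required zeros force all other values of
    \<alpha> and \<beta> in terms of \<open>t = \<alpha> n\<close>. The total is then
    \<open>- X - (n - 2) * t\<close>, which determines \<open>t\<close>.\<close>
  define X where "X = (\<Sum>i\<in>{1..<n}. c i n) + (\<Sum>j\<in>{1..<n}. c n j)"
  define t where "t = - X / (of_nat n - 2)"
  define \<alpha> where "\<alpha> i = (if i = n then t else - c i n)" for i
  define \<beta> where "\<beta> j = (if j = n then 0 else - c n j - t)" for j
  define d where "d i j = c i j + \<alpha> i + \<beta> j" for i j
  have split: "{1..n} = insert n {1..<n}"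
    using n by auto
  have "(\<Sum>i=1..n. \<alpha> i) = t - (\<Sum>i\<in>{1..<n}. c i n)"
    unfolding split by (simp add: \<alpha>_def sum_negf)
  moreover have "(\<Sum>j=1..n. \<beta> j) = - (\<Sum>j\<in>{1..<n}. c n j) - (of_nat n - 1) * t"
    unfolding split using n by (simp add: \<beta>_def sum_negf sum_subtractf of_nat_diff)
  ultimately have "(\<Sum>i=1..n. \<alpha> i) + (\<Sum>j=1..n. \<beta> j) = - X - (of_nat n - 2) * t"
    by (simp add: X_def left_diff_distrib)
  moreover have "of_nat n - (2::complex) \<noteq> 0"
    using n of_nat_eq_iff[of n 2, where 'a = complex] by simp
  ultimately have zero: "(\<Sum>i=1..n. \<alpha> i) + (\<Sum>j=1..n. \<beta> j) = 0"
    by (simp add: t_def)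
  show thesis
  proof
    fix \<pi> assume "\<pi> permutes {1..n}"
    then have "(\<Sum>i=1..n. \<beta> (\<pi> i)) = (\<Sum>j=1..n. \<beta> j)"
      using sum.permute[of \<pi> "{1..n}" \<beta>] by (simp add: comp_def)
    then show "coset_sum n c \<pi> = coset_sum n d \<pi>"
      using zero by (simp add: coset_sum_def d_def sum.distrib algebra_simps)
  qed (auto simp: d_def \<alpha>_def \<beta>_def)
qed

text \<open>A derangement meets no diagonal entry, and the last row and column contribute nothing.
  What remains is row \<sigma> of \<open>M\<close> applied to the coefficients.\<close>

lemma coset_sum_eq_sum_M_columns:
  assumes \<sigma>: "\<sigma> permutes {1..n}" and der: "\<And>i. i \<in> {1..n} \<Longrightarrow> \<sigma> i \<noteq> i"
    and row: "\<And>i. i \<in> {1..<n} \<Longrightarrow> c i n = 0" and col: "\<And>j. j \<in> {1..<n} \<Longrightarrow> c n j = 0"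
  shows "coset_sum n c \<sigma> = (\<Sum>k\<in>M_columns n. (case k of (i, j) \<Rightarrow> c i j) * M_matrix \<sigma> k)"
proof -
  have "coset_sum n c \<sigma> = (\<Sum>i=1..n. \<Sum>j=1..n. c i j * M_matrix \<sigma> (i, j))"
    using permutes_in_image[OF \<sigma>]
    by (auto simp: coset_sum_def M_matrix_def if_distrib cong: if_cong intro!: sum.cong)
  also have "\<dots> = (\<Sum>k\<in>{1..n} \<times> {1..n}. (case k of (i, j) \<Rightarrow> c i j) * M_matrix \<sigma> k)"
    by (simp add: sum.cartesian_product case_prod_unfold)
  also have "\<dots> = (\<Sum>k\<in>M_columns n. (case k of (i, j) \<Rightarrow> c i j) * M_matrix \<sigma> k)"
  proof (rule sum.mono_neutral_right)
    show "\<forall>k\<in>{1..n} \<times> {1..n} - M_columns n. (case k of (i, j) \<Rightarrow> c i j) * M_matrix \<sigma> k = 0"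
    proof safe
      fix i j assume ij: "i \<in> {1..n}" "j \<in> {1..n}" "(i, j) \<notin> M_columns n"
      \<comment> \<open>The corner \<open>(n, n)\<close> falls under the diagonal case, so
        \<open>c n n\<close> may be nonzero.\<close>
      then consider "i = j" | "i = n" "j \<in> {1..<n}" | "j = n" "i \<in> {1..<n}"
        by (fastforce simp: M_columns_def)
      then show "c i j * M_matrix \<sigma> (i, j) = 0"
        using ij der row col by cases (auto simp: M_matrix_def)
    qed
  qed (auto simp: M_columns_def)
  finally show ?thesis .
qed

section \<open>Permutation groups: fixed points and independent sets\<close>

locale permutation_subgroup =
  fixes n :: nat and G :: "(nat \<Rightarrow> nat) set"
  assumes subgroup_sym: "subgroup G (sym_group n)"
begin

lemma permutes: "\<pi> \<in> G \<Longrightarrow> \<pi> permutes {1..n}"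
  using subgroup.mem_carrier[OF subgroup_sym] by (simp add: sym_group_carrier)

lemma id_closed: "id \<in> G"
  using subgroup.one_closed[OF subgroup_sym] by (simp add: sym_group_one)

lemma comp_closed: "\<pi> \<in> G \<Longrightarrow> \<sigma> \<in> G \<Longrightarrow> \<pi> \<circ> \<sigma> \<in> G"
  using subgroup.m_closed[OF subgroup_sym] by (simp add: sym_group_mult)

lemma inv_closed: "\<pi> \<in> G \<Longrightarrow> inv' \<pi> \<in> G"
  using subgroup.m_inv_closed[OF subgroup_sym] subgroup.mem_carrier[OF subgroup_sym]
  by (metis sym_group_inv_equality)

lemma finite_carrier: "finite G"
  by (rule finite_subset[OF _ finite_permutations[of "{1..n}"]])
    (use permutes in \<open>auto simp del: One_nat_def\<close>)

lemma inv_comp: "\<pi> \<in> G \<Longrightarrow> inv' \<pi> \<circ> \<pi> = id"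
  and comp_inv: "\<pi> \<in> G \<Longrightarrow> \<pi> \<circ> inv' \<pi> = id"
  using permutes_inv_o permutes by blast+

text \<open>Jordan's theorem for the action of the stabilizer of \<open>x\<close> on the remaining points.\<close>

lemma ex_unique_fixpoint:
  assumes two: "two_transitive n G" and n: "3 \<le> n" and x: "x \<in> {1..n}"
  obtains g where "g \<in> G" "g x = x" "\<And>i. i \<in> {1..n} \<Longrightarrow> g i = i \<Longrightarrow> i = x"
proof -
  define H where "H = {g \<in> G. g x = x}"
  define Y where "Y = {1..n} - {x}"
  have finY: "finite Y" and cardY: "2 \<le> card Y"
    using n x by (auto simp: Y_def)
  have finH: "finite H"
    using finite_carrier by (simp add: H_def)
  have idH: "id \<in> H"
    using id_closed by (simp add: H_def)
  have imgY: "g y \<in> Y" if "g \<in> H" "y \<in> Y" for g y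
    using that permutes_in_image[OF permutes, of g y] permutes_inj[OF permutes, of g]
    by (auto simp: H_def Y_def dest: injD[of g y x])
  \<comment> \<open>Orbit-stabilizer: 2-transitivity makes \<open>Y\<close> a single orbit of
    \<open>H\<close>, and left multiplication by \<open>h\<close> matches the elements fixing
    \<open>y\<close> with those sending \<open>y\<close> to \<open>z\<close>.\<close>
  have stab: "card Y * card {g \<in> H. g y = y} = card H" if y: "y \<in> Y" for y
  proof -
    have "card {g \<in> H. g y = z} = card {g \<in> H. g y = y}" if z: "z \<in> Y" for z
    proof -
      obtain h where h: "h \<in> G" "h x = x" "h y = z"
        using two x y z unfolding two_transitive_def Y_def by (metis Diff_iff singletonI)
      have "bij_betw (\<lambda>g. h \<circ> g) {g \<in> H. g y = y} {g \<in> H. g y = z}"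
      proof (rule bij_betwI[where g = "\<lambda>g. inv' h \<circ> g"])
        show "(\<lambda>g. h \<circ> g) \<in> {g \<in> H. g y = y} \<rightarrow> {g \<in> H. g y = z}"
          using h by (auto simp: H_def comp_closed)
        show "(\<lambda>g. inv' h \<circ> g) \<in> {g \<in> H. g y = z} \<rightarrow> {g \<in> H. g y = y}"
          using h permutes_inv_eq[OF permutes[OF h(1)]]
          by (auto simp: H_def comp_closed inv_closed)
      qed (use h in \<open>simp_all add: inv_comp comp_inv flip: comp_assoc\<close>)
      then show ?thesis
        by (simp add: bij_betw_same_card)
    qed
    then have "card Y * card {g \<in> H. g y = y} = (\<Sum>z\<in>Y. card {g \<in> H. g y = z})"
      by simp
    also have "\<dots> = card (\<Union>z\<in>Y. {g \<in> H. g y = z})"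
      using finY finH by (intro card_UN_disjoint[symmetric]) auto
    also have "(\<Union>z\<in>Y. {g \<in> H. g y = z}) = H"
      using imgY y by auto
    finally show ?thesis .
  qed
  have "\<exists>g\<in>H. \<forall>y\<in>Y. g y \<noteq> y"
  proof (rule ccontr)
    assume "\<not> ?thesis"
    then have fixed: "1 \<le> card {y \<in> Y. g y = y}" if "g \<in> H" for g
      using that finY by (auto simp: Suc_le_eq card_gt_0_iff)
    \<comment> \<open>The inequality is strict because \<open>id\<close> fixes at least two points
      of \<open>Y\<close>. Counting by points instead gives exactly \<open>card H\<close>, by
      \<open>stab\<close>.\<close>
    have "(\<Sum>g\<in>H. 1) < (\<Sum>g\<in>H. card {y \<in> Y. g y = y})"
      using fixed idH cardY by (intro sum_strict_mono_ex1 finH) (auto intro!: bexI[of _ id])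
    also have "\<dots> = (\<Sum>y\<in>Y. card {g \<in> H. g y = y})"
      using sum.swap[of "\<lambda>g y. of_bool (g y = y) :: nat" Y H] finH finY by (simp add: Int_def)
    finally have "card Y * card H < card Y * (\<Sum>y\<in>Y. card {g \<in> H. g y = y})"
      using cardY by simp
    also have "\<dots> = card Y * card H"
      using stab by (simp add: sum_distrib_left)
    finally show False
      by simp
  qed
  then obtain g where "g \<in> H" "\<forall>y\<in>Y. g y \<noteq> y"
    by blast
  then show thesis
    by (intro that[of g]) (auto simp: H_def Y_def)
qed

text \<open>Right translation by an element of \<open>G\<close> leaves every quotient
  \<open>\<pi> \<circ> inv' \<tau>\<close> unchanged.\<close>

lemma independent_wrt_translate:
  assumes S: "independent_wrt G C S" and \<sigma>: "\<sigma> \<in> G"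
  shows "independent_wrt G C ((\<lambda>\<pi>. \<pi> \<circ> inv' \<sigma>) ` S)"
proof -
  have "(\<pi> \<circ> inv' \<sigma>) \<circ> inv' (\<tau> \<circ> inv' \<sigma>) = \<pi> \<circ> inv' \<tau>" if "\<tau> \<in> G" for \<pi> \<tau> :: "nat \<Rightarrow> nat"
  proof -
    have "inv' (\<tau> \<circ> inv' \<sigma>) = \<sigma> \<circ> inv' \<tau>"
      using permutes[OF that] permutes[OF \<sigma>]
      by (simp add: o_inv_distrib permutes_bij bij_imp_bij_inv inv_inv_eq)
    then show ?thesis
      using inv_comp[OF \<sigma>] by (simp add: fun_eq_iff)
  qed
  then show ?thesis
    using S \<sigma> unfolding independent_wrt_def
    by (auto simp: comp_closed inv_closed subset_iff)
qed

lemma max_independent_wrt_translate: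
  assumes S: "max_independent_wrt G C S" and \<sigma>: "\<sigma> \<in> G"
  shows "max_independent_wrt G C ((\<lambda>\<pi>. \<pi> \<circ> inv' \<sigma>) ` S)"
proof -
  have "\<pi> = \<tau>" if "\<pi> \<circ> inv' \<sigma> = \<tau> \<circ> inv' \<sigma>" for \<pi> \<tau> :: "nat \<Rightarrow> nat"
    using that inv_comp[OF \<sigma>] by (metis comp_assoc comp_id)
  then have "card ((\<lambda>\<pi>. \<pi> \<circ> inv' \<sigma>) ` S) = card S"
    by (intro card_image inj_onI)
  then show ?thesis
    using S independent_wrt_translate[OF _ \<sigma>] by (simp add: max_independent_wrt_def)
qed

lemma max_independent_wrt_nonempty:
  assumes "max_independent_wrt G C S" and "id \<notin> C"
  shows "S \<noteq> {}"
proof -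
  have "independent_wrt G C {id}"
    using assms(2) id_closed by (simp add: independent_wrt_def)
  then have "card {id :: nat \<Rightarrow> nat} \<le> card S"
    using assms(1) by (auto simp: max_independent_wrt_def)
  then show ?thesis
    by auto
qed

lemma derangement_classes_Union:
  assumes "\<exists>\<K> \<subseteq> derangement_classes n G. C = \<Union>\<K>" and "\<sigma> \<in> C"
  shows "\<sigma> \<in> G" and "\<And>i. i \<in> {1..n} \<Longrightarrow> \<sigma> i \<noteq> i"
proof -
  obtain K where K: "K \<in> derangement_classes n G" "\<sigma> \<in> K"
    using assms by auto
  then show "\<sigma> \<in> G"
    by (auto simp: derangement_classes_def conj_class_def intro!: comp_closed inv_closed)
  show "\<sigma> i \<noteq> i" if "i \<in> {1..n}" for i
    using K that by (auto simp: derangement_classes_def)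
qed

lemma indicator_eq_fixpoint_sum_imp_stabilizer:
  assumes two: "two_transitive n G" and n: "3 \<le> n"
    and S: "S \<subseteq> G" "id \<in> S"
    and sum: "\<And>\<pi>. \<pi> \<in> G \<Longrightarrow> (indicator S \<pi> :: complex) = (\<Sum>i | i \<in> {1..n} \<and> \<pi> i = i. b i)"
  shows "\<exists>k\<in>{1..n}. S = {\<pi> \<in> G. \<pi> k = k}"
proof -
  have b01: "b x \<in> {0, 1}" if x: "x \<in> {1..n}" for x
  proof -
    obtain g where g: "g \<in> G" "g x = x" "\<And>i. i \<in> {1..n} \<Longrightarrow> g i = i \<Longrightarrow> i = x"
      using ex_unique_fixpoint[OF two n x] by blast
    then have "{i. i \<in> {1..n} \<and> g i = i} = {x}"
      using x by blast
    then have "b x = indicator S g"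
      using sum[OF g(1)] by simp
    then show ?thesis
      by (simp add: indicator_def)
  qed
  define B where "B = {i \<in> {1..n}. b i = 1}"
  have b: "b i = of_bool (i \<in> B)" if "i \<in> {1..n}" for i
    using b01[OF that] that by (auto simp: B_def)
  have "(1::complex) = (\<Sum>i=1..n. b i)"
    using sum[OF id_closed] S by (simp del: atLeastAtMost_iff)
  also have "\<dots> = of_nat (card B)"
  proof -
    have "(\<Sum>i=1..n. b i) = (\<Sum>i=1..n. of_bool (i \<in> B))"
      by (intro sum.cong refl b)
    also have "{1..n} \<inter> B = B"
      by (auto simp: B_def)
    then have "(\<Sum>i=1..n. of_bool (i \<in> B)) = (of_nat (card B) :: complex)"
      by simp
    finally show ?thesis .
  qed
  \<comment> \<open>The coefficients are 0 or 1 with sum 1, so exactly one survives, and the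
    fixed-point sum only tests whether \<pi> fixes that point.\<close>
  finally have "card B = 1"
    by (metis of_nat_1 of_nat_eq_iff)
  then obtain k where k: "B = {k}"
    by (auto simp: card_1_singleton_iff)
  then have k_in: "k \<in> {1..n}"
    by (auto simp: B_def)
  have "\<pi> \<in> S \<longleftrightarrow> \<pi> k = k" if "\<pi> \<in> G" for \<pi>
  proof -
    have "(indicator S \<pi> :: complex) = (\<Sum>i | i \<in> {1..n} \<and> \<pi> i = i. if i = k then 1 else 0)"
      unfolding sum[OF that] using b by (intro sum.cong) (auto simp: k)
    also have "\<dots> = of_bool (\<pi> k = k)"
      using k_in by simp
    finally show ?thesis
      by (auto simp: indicator_def split: if_splits)
  qed
  then have "S = {\<pi> \<in> G. \<pi> k = k}"
    using S by auto
  then show ?thesis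
    using k_in by blast
qed

end

section \<open>Degree at most 2, and assembly of the proof\<close>

text \<open>At most one other point is left, so its image is forced. This serves the degrees that
  the normal form does not cover.\<close>

lemma permutes_le_2_eqI:
  fixes n :: nat
  assumes "n \<le> 2" "\<pi> permutes {1..n}" "\<sigma> permutes {1..n}" "i \<in> {1..n}" "\<pi> i = \<sigma> i"
  shows "\<pi> = \<sigma>"
proof
  fix j
  show "\<pi> j = \<sigma> j"
  proof (cases "j \<in> {1..n} \<and> j \<noteq> i")
    case True
    then have "\<pi> j \<in> {1..n}" "\<sigma> j \<in> {1..n}" "\<pi> i \<in> {1..n}"
      using assms by (simp_all add: permutes_in_image del: atLeastAtMost_iff)
    moreover have "\<pi> j \<noteq> \<pi> i" "\<sigma> j \<noteq> \<sigma> i"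
      using True inj_eq[OF permutes_inj[OF assms(2)]] inj_eq[OF permutes_inj[OF assms(3)]] by auto
    ultimately show ?thesis
      using assms by auto
  next
    case False
    then show ?thesis
      using assms by (metis permutes_not_in)
  qed
qed

theorem theorem7p2:
  fixes n :: nat and G C :: "(nat \<Rightarrow> nat) set"
  assumes "1 \<le> n"
    and "subgroup G (sym_group n)"
    and "two_transitive n G"
    and "\<exists>\<K> \<subseteq> derangement_classes n G. C = \<Union>\<K>"
    and "EKR_property n G C"
    and "\<And>S. max_independent_wrt G C S \<Longrightarrow>
           \<exists>u \<in> character_module G trivial_character.
           \<exists>w \<in> character_module G (standard_character n).
             (indicator S :: (nat \<Rightarrow> nat) \<Rightarrow> complex) = u + w"
    and "matrix_rank C (M_columns n) M_matrix = (n - 1) * (n - 2)"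
  shows "strict_EKR_property n G C"
proof -
  interpret permutation_subgroup n G
    by (rule permutation_subgroup.intro) fact
  note C = derangement_classes_Union[OF assms(4)]
  have id_C: "id \<notin> C"
    using C(2)[of id 1] \<open>1 \<le> n\<close> by auto
  have stabilizer: "\<exists>k\<in>{1..n}. S = {\<pi> \<in> G. \<pi> k = k}"
    if n: "3 \<le> n" and max: "max_independent_wrt G C S" and id_S: "id \<in> S" for S
  proof -
    have S: "S \<subseteq> G" "\<And>\<pi> \<sigma>. \<pi> \<in> S \<Longrightarrow> \<sigma> \<in> S \<Longrightarrow> \<pi> \<circ> inv' \<sigma> \<notin> C"
      using max by (auto simp: max_independent_wrt_def independent_wrt_def)
    obtain u w where uw: "u \<in> character_module G trivial_character"
        "w \<in> character_module G (standard_character n)" "(indicator S :: _ \<Rightarrow> complex) = u + w"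
      using assms(6)[OF max] by blast
    obtain c where c: "\<And>\<pi>. \<pi> \<in> G \<Longrightarrow> u \<pi> = coset_sum n c \<pi>"
      using trivial_module_coset_sum[OF uw(1) \<open>1 \<le> n\<close>] by blast
    obtain c' where c': "\<And>\<pi>. \<pi> \<in> G \<Longrightarrow> w \<pi> = coset_sum n c' \<pi>"
      using standard_module_coset_sum[OF uw(2) \<open>1 \<le> n\<close> permutes] by blast
    obtain d where d: "\<And>\<pi>. \<pi> permutes {1..n} \<Longrightarrow>
        coset_sum n (\<lambda>i j. c i j + c' i j) \<pi> = coset_sum n d \<pi>"
      and row: "\<And>i. i \<in> {1..<n} \<Longrightarrow> d i n = 0" and col: "\<And>j. j \<in> {1..<n} \<Longrightarrow> d n j = 0"
      using coset_sum_normal_form[OF n, of "\<lambda>i j. c i j + c' i j"] by blast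
    have ind: "indicator S \<pi> = coset_sum n d \<pi>" if "\<pi> \<in> G" for \<pi>
      using d[OF permutes[OF that]] c[OF that] c'[OF that] uw(3)
      by (simp add: coset_sum_def sum.distrib)
    have kernel: "(case k of (i, j) \<Rightarrow> d i j) = 0" if "k \<in> M_columns n" for k
    proof (rule matrix_rank_full_imp_kernel_trivial[OF finite_M_columns _ _ that])
      show "matrix_rank C (M_columns n) M_matrix = card (M_columns n)"
        using assms(7) by (simp add: card_M_columns)
      fix \<sigma> assume \<sigma>: "\<sigma> \<in> C"
      \<comment> \<open>Otherwise \<sigma> would be the quotient of the two members \<sigma> and
        \<open>id\<close> of \<open>S\<close>.\<close>
      then have "\<sigma> \<notin> S"
        using S(2)[of \<sigma> id] id_S by auto
      then have "coset_sum n d \<sigma> = 0"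
        using ind[OF C(1)[OF \<sigma>]] by simp
      then show "(\<Sum>k\<in>M_columns n. (case k of (i, j) \<Rightarrow> d i j) * M_matrix \<sigma> k) = 0"
        using coset_sum_eq_sum_M_columns[OF permutes[OF C(1)[OF \<sigma>]] C(2)[OF \<sigma>], of d] row col
        by simp
    qed
    have off: "d i j = 0" if "i \<in> {1..n}" "j \<in> {1..n}" "i \<noteq> j" for i j
    proof (cases "i = n \<or> j = n")
      case True
      then show ?thesis
        using that row[of i] col[of j] by auto
    next
      case False
      then have "(i, j) \<in> M_columns n"
        using that by (auto simp: M_columns_def)
      then show ?thesis
        using kernel by fastforce
    qed
    show ?thesis
    proof (rule indicator_eq_fixpoint_sum_imp_stabilizer[OF assms(3) n S(1) id_S])
      fix \<pi> assume \<pi>: "\<pi> \<in> G"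
      have "d i (\<pi> i) = 0" if "i \<in> {1..n}" "\<pi> i \<noteq> i" for i
        using that permutes_in_image[OF permutes[OF \<pi>]] by (intro off) auto
      then show "indicator S \<pi> = (\<Sum>i | i \<in> {1..n} \<and> \<pi> i = i. d i i)"
        unfolding ind[OF \<pi>] coset_sum_def
        by (intro sum.mono_neutral_cong_right) auto
    qed
  qed
  have "\<exists>i\<in>{1..n}. \<exists>j\<in>{1..n}. S = {\<pi> \<in> G. \<pi> i = j}" if max: "max_independent_wrt G C S" for S
  proof -
    have S: "S \<subseteq> G"
      using max by (auto simp: max_independent_wrt_def independent_wrt_def)
    obtain \<sigma> where \<sigma>: "\<sigma> \<in> S"
      using max_independent_wrt_nonempty[OF max id_C] by blast
    then have \<sigma>_G: "\<sigma> \<in> G"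
      using S by blast
    show ?thesis
    proof (cases "3 \<le> n")
      case True
      let ?S = "(\<lambda>\<pi>. \<pi> \<circ> inv' \<sigma>) ` S"
      have "id \<in> ?S"
        using \<sigma> comp_inv[OF \<sigma>_G] by (metis image_eqI)
      then obtain k where k: "k \<in> {1..n}" "?S = {\<pi> \<in> G. \<pi> k = k}"
        using stabilizer[OF True max_independent_wrt_translate[OF max \<sigma>_G]] by blast
      \<comment> \<open>Undoing the translation turns the stabilizer of \<open>k\<close> into the
        coset of elements sending \<open>inv' \<sigma> k\<close> to \<open>k\<close>.\<close>
      have "\<pi> \<in> S \<longleftrightarrow> \<pi> (inv' \<sigma> k) = k" if \<pi>: "\<pi> \<in> G" for \<pi>
      proof -
        have "\<pi> \<in> S \<longleftrightarrow> \<pi> \<circ> inv' \<sigma> \<in> ?S"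
          using inv_comp[OF \<sigma>_G] by (auto simp: image_iff) (metis comp_assoc comp_id)
        then show ?thesis
          using k(2) \<pi> \<sigma>_G by (simp add: comp_closed inv_closed)
      qed
      then have "S = {\<pi> \<in> G. \<pi> (inv' \<sigma> k) = k}"
        using S by auto
      moreover have "inv' \<sigma> k \<in> {1..n}"
        using k(1) permutes_in_image[OF permutes[OF inv_closed[OF \<sigma>_G]]] by blast
      ultimately show ?thesis
        using k(1) by blast
    next
      case False
      \<comment> \<open>Here an element of \<open>G\<close> is determined by one value. Point
        stabilizers are thus trivial, the EKR bound is 1, and the singleton \<open>S\<close> is the
        coset prescribed by its value at 1.\<close>
      then have eqI: "\<pi> = \<tau>" if "\<pi> \<in> G" "\<tau> \<in> G" "i \<in> {1..n}" "\<pi> i = \<tau> i" for \<pi> \<tau> i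
        using that by (intro permutes_le_2_eqI[of n \<pi> \<tau> i] permutes) auto
      have "card (point_stabilizer G i) \<le> 1" if "i \<in> {1..n}" for i
      proof -
        have "point_stabilizer G i \<subseteq> {id}"
          using eqI[OF _ id_closed that] by (auto simp: point_stabilizer_def)
        from card_mono[OF _ this] show ?thesis
          by simp
      qed
      then have "Max ((\<lambda>i. card (point_stabilizer G i)) ` {1..n}) \<le> 1"
        using \<open>1 \<le> n\<close> by simp
      moreover have "card S \<le> Max ((\<lambda>i. card (point_stabilizer G i)) ` {1..n})"
        using assms(5) max by (simp add: EKR_property_def max_independent_wrt_def)
      ultimately have "card S \<le> 1"
        by linarith
      then have "S = {\<sigma>}"
        using \<sigma> finite_subset[OF S finite_carrier] by (auto simp: card_le_Suc0_iff_eq)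
      then have "S = {\<pi> \<in> G. \<pi> 1 = \<sigma> 1}"
        using eqI[OF _ \<sigma>_G, of _ 1] \<sigma>_G \<open>1 \<le> n\<close> by auto
      moreover have "\<sigma> 1 \<in> {1..n}"
        using permutes_in_image[OF permutes[OF \<sigma>_G], of 1] \<open>1 \<le> n\<close> by simp
      ultimately show ?thesis
        using \<open>1 \<le> n\<close> by (intro bexI[of _ 1] bexI[of _ "\<sigma> 1"]) simp_all
    qed
  qed
  then show ?thesis
    using assms(5) by (simp add: strict_EKR_property_def)
qed

end
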